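(* Let $\gamma_n>0$ and $y\in\mathbb R^n$. The regularized least squares problem $$\hat f_\gamma:=\operatorname*{argmin}_{f\in\mathcal H^\beta}\ \frac1n\|\hat S_n\mathcal Af-y\|^2+\gamma_n\|f\|_{\mathcal H^\beta}^2$$ has the finite-dimensional closed-form solution $$\hat f_\gamma=\mathcal A\Sigma^{\beta-1}\hat S_n^*\hat\theta_n,\qquad \hat\theta_n=\big(\hat S_n\mathcal A^2\Sigma^{\beta-1}\hat S_n^*+n\gamma_nI\big)^{-1}y\in\mathbb R^n.$$
   Context: $\mathcal H$ is a separable reproducing kernel Hilbert space on $\mathcal X$ with kernel $K(s,t)=\sum_{i\ge1}\lambda_i\psi_i(s)\psi_i(t)$, $\lambda_i>0$, $(\psi_i)$ an orthonormal basis of $L^2(\rho_{\mathcal X})$ for a probability measure $\rho_{\mathcal X}$; $K_x=K(x,\cdot)$. For $\beta\in[0,1]$, $\mathcal H^\beta=\{\sum_i a_i\lambda_i^{\beta/2}\psi_i:\sum_i a_i^2<\infty\}$ with norm $\|\sum_i a_i\lambda_i^{\beta/2}\psi_i\|_{\mathcal H^\beta}=(\sum_ia_i^2)^{1/2}$ (equivalently $\|f\|_{\mathcal H^\beta}=\|\Sigma^{(1-\beta)/2}f\|_{\mathcal H}$). $\Sigma=\mathbb E[K_x\otimes K_x]$ is the covariance operator, $\Sigma\psi_i=\lambda_i\psi_i$, and $\mathcal A$ is a self-adjoint operator co-diagonalizable with $\Sigma$: $\mathcal A\psi_i=p_i\psi_i$; powers are defined spectrally. Given points $x_1,\dots,x_n\in\mathcal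 X$: $\hat S_nf=(f(x_1),\dots,f(x_n))$, i.e. $(\hat S_n\mathcal Af)_j=\sum_i p_i\langle f,\psi_i\rangle_{L^2}\psi_i(x_j)$, and $\hat S_n^*\theta=\sum_{j=1}^n\theta_jK_{x_j}$. Concretely, $\hat S_n\mathcal A^2\Sigma^{\beta-1}\hat S_n^*$ is the $n\times n$ matrix with entries $\sum_ip_i^2\lambda_i^\beta\psi_i(x_j)\psi_i(x_l)$ and $\mathcal A\Sigma^{\beta-1}\hat S_n^*\theta=\sum_ip_i\lambda_i^\beta\big(\sum_j\theta_j\psi_i(x_j)\big)\psi_i$. It is understood that $\sum_ip_i^2\lambda_i^\beta\psi_i(x_j)^2<\infty$ for every $j$, so that these expressions (and $\hat S_n\mathcal A$ on $\mathcal H^\beta$) are well defined. *)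

theory Defs
  imports "HOL-Probability.Probability"
begin

text \<open>Elements of \<open>L\<^sup>2(\<rho>)\<close> are represented by square-integrable functions; equality in
  \<open>L\<^sup>2(\<rho>)\<close> is equality almost everywhere.\<close>

definition L2_space :: "'x measure \<Rightarrow> ('x \<Rightarrow> real) set" where
  "L2_space \<rho> = {f \<in> borel_measurable \<rho>. integrable \<rho> (\<lambda>x. (f x)\<^sup>2)}"

definition L2_inner :: "'x measure \<Rightarrow> ('x \<Rightarrow> real) \<Rightarrow> ('x \<Rightarrow> real) \<Rightarrow> real" where
  "L2_inner \<rho> f g = (\<integral>x. f x * g x \<partial>\<rho>)"

definition L2_norm :: "'x measure \<Rightarrow> ('x \<Rightarrow> real) \<Rightarrow> real" where
  "L2_norm \<rho> f = sqrt (L2_inner \<rho> f f)"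

definition L2_sums :: "'x measure \<Rightarrow> (nat \<Rightarrow> 'x \<Rightarrow> real) \<Rightarrow> ('x \<Rightarrow> real) \<Rightarrow> bool" where
  "L2_sums \<rho> u f \<longleftrightarrow> f \<in> L2_space \<rho> \<and> (\<forall>i. u i \<in> L2_space \<rho>) \<and>
     (\<lambda>N. L2_norm \<rho> (\<lambda>x. f x - (\<Sum>i<N. u i x))) \<longlonglongrightarrow> 0"

definition L2_orthonormal_basis :: "'x measure \<Rightarrow> (nat \<Rightarrow> 'x \<Rightarrow> real) \<Rightarrow> bool" where
  "L2_orthonormal_basis \<rho> \<psi> \<longleftrightarrow>
     (\<forall>i. \<psi> i \<in> L2_space \<rho>) \<and>
     (\<forall>i k. L2_inner \<rho> (\<psi> i) (\<psi> k) = (if i = k then 1 else 0)) \<and>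
     (\<forall>f \<in> L2_space \<rho>. L2_sums \<rho> (\<lambda>i x. L2_inner \<rho> f (\<psi> i) * \<psi> i x) f)"

text \<open>The covariance operator \<open>E[K\<^sub>x \<otimes> K\<^sub>x]\<close>: by the reproducing property it maps \<open>f\<close> to
  \<open>E[f(x) K\<^sub>x]\<close>.\<close>

definition covariance_op ::
  "'x measure \<Rightarrow> ('x \<Rightarrow> 'x \<Rightarrow> real) \<Rightarrow> ('x \<Rightarrow> real) \<Rightarrow> 'x \<Rightarrow> real" where
  "covariance_op \<rho> K f = (\<lambda>s. \<integral>x. f x * K x s \<partial>\<rho>)"

text \<open>\<open>spectral_image \<rho> \<psi> m f g\<close> says that \<open>f\<close> lies in the domain of the (possibly unbounded)
  operator with eigenvalues \<open>m i\<close> on \<open>\<psi> i\<close>, and that the operator maps \<open>f\<close> to \<open>g\<close>. If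
  \<open>\<A> \<psi>\<^sub>i = p\<^sub>i \<psi>\<^sub>i\<close> and \<open>\<Sigma> \<psi>\<^sub>i = \<lambda>\<^sub>i \<psi>\<^sub>i\<close>, the operator \<open>\<A>\<^sup>a \<Sigma>\<^sup>s\<close> has eigenvalues
  \<open>p\<^sub>i\<^sup>a \<lambda>\<^sub>i\<^sup>s\<close>; it is not read as a composition, since \<open>\<Sigma>\<^sup>s f\<close> alone need not lie in \<open>L\<^sup>2\<close>
  for \<open>s < 0\<close>.\<close>

definition spectral_image ::
  "'x measure \<Rightarrow> (nat \<Rightarrow> 'x \<Rightarrow> real) \<Rightarrow> (nat \<Rightarrow> real) \<Rightarrow> ('x \<Rightarrow> real) \<Rightarrow> ('x \<Rightarrow> real) \<Rightarrow> bool" where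
  "spectral_image \<rho> \<psi> m f g \<longleftrightarrow> f \<in> L2_space \<rho> \<and>
     L2_sums \<rho> (\<lambda>i x. m i * L2_inner \<rho> f (\<psi> i) * \<psi> i x) g"

text \<open>The sampling operator \<open>S\<^sub>n\<close> composed with the operator with eigenvalues \<open>m i\<close>. The values at
  the sample points are those of the pointwise eigenfunction series, so they do not depend on the
  chosen representative of \<open>f\<close>.\<close>

definition sample_spectral ::
  "'x measure \<Rightarrow> (nat \<Rightarrow> 'x \<Rightarrow> real) \<Rightarrow> (nat \<Rightarrow> real) \<Rightarrow> ('n::finite \<Rightarrow> 'x) \<Rightarrow> ('x \<Rightarrow> real) \<Rightarrow> real ^ 'n"
where
  "sample_spectral \<rho> \<psi> m x f = (\<chi> j. \<Sum>i. m i * L2_inner \<rho> f (\<psi> i) * \<psi> i (x j))"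

definition sample_adjoint ::
  "('x \<Rightarrow> 'x \<Rightarrow> real) \<Rightarrow> ('n::finite \<Rightarrow> 'x) \<Rightarrow> real ^ 'n \<Rightarrow> 'x \<Rightarrow> real" where
  "sample_adjoint K x \<theta> = (\<lambda>t. \<Sum>j\<in>UNIV. \<theta> $ j * K (x j) t)"

definition Hpow_rep ::
  "'x measure \<Rightarrow> (nat \<Rightarrow> real) \<Rightarrow> (nat \<Rightarrow> 'x \<Rightarrow> real) \<Rightarrow> real \<Rightarrow> (nat \<Rightarrow> real) \<Rightarrow> ('x \<Rightarrow> real) \<Rightarrow> bool"
where
  "Hpow_rep \<rho> lam \<psi> \<beta> a f \<longleftrightarrow> summable (\<lambda>i. (a i)\<^sup>2) \<and>
     L2_sums \<rho> (\<lambda>i x. a i * lam i powr (\<beta> / 2) * \<psi> i x) f"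

definition Hpow ::
  "'x measure \<Rightarrow> (nat \<Rightarrow> real) \<Rightarrow> (nat \<Rightarrow> 'x \<Rightarrow> real) \<Rightarrow> real \<Rightarrow> ('x \<Rightarrow> real) set" where
  "Hpow \<rho> lam \<psi> \<beta> = {f. \<exists>a. Hpow_rep \<rho> lam \<psi> \<beta> a f}"

text \<open>The coefficient sequence is unique because the \<open>\<psi> i\<close> are orthonormal and \<open>lam i > 0\<close>.\<close>

definition Hpow_norm ::
  "'x measure \<Rightarrow> (nat \<Rightarrow> real) \<Rightarrow> (nat \<Rightarrow> 'x \<Rightarrow> real) \<Rightarrow> real \<Rightarrow> ('x \<Rightarrow> real) \<Rightarrow> real" where
  "Hpow_norm \<rho> lam \<psi> \<beta> f = sqrt (\<Sum>i. ((THE a. Hpow_rep \<rho> lam \<psi> \<beta> a f) i)\<^sup>2)"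

definition rls_objective ::
  "'x measure \<Rightarrow> (nat \<Rightarrow> real) \<Rightarrow> (nat \<Rightarrow> 'x \<Rightarrow> real) \<Rightarrow> (nat \<Rightarrow> real) \<Rightarrow> real \<Rightarrow> real \<Rightarrow>
   ('n::finite \<Rightarrow> 'x) \<Rightarrow> real ^ 'n \<Rightarrow> ('x \<Rightarrow> real) \<Rightarrow> real" where
  "rls_objective \<rho> lam \<psi> p \<beta> \<gamma> x y f =
     1 / real CARD('n) * (norm (sample_spectral \<rho> \<psi> p x f - y))\<^sup>2
     + \<gamma> * (Hpow_norm \<rho> lam \<psi> \<beta> f)\<^sup>2"

text \<open>The matrix of \<open>S\<^sub>n \<A>\<^sup>2 \<Sigma>\<^bsup>\<beta>-1\<^esup> S\<^sub>n\<^sup>* + n \<gamma> I\<close>.\<close>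

definition rls_matrix ::
  "'x measure \<Rightarrow> ('x \<Rightarrow> 'x \<Rightarrow> real) \<Rightarrow> (nat \<Rightarrow> real) \<Rightarrow> (nat \<Rightarrow> 'x \<Rightarrow> real) \<Rightarrow> (nat \<Rightarrow> real) \<Rightarrow>
   real \<Rightarrow> real \<Rightarrow> ('n::finite \<Rightarrow> 'x) \<Rightarrow> real ^ 'n ^ 'n" where
  "rls_matrix \<rho> K lam \<psi> p \<beta> \<gamma> x =
     matrix (\<lambda>\<theta>. sample_spectral \<rho> \<psi> (\<lambda>i. (p i)\<^sup>2 * lam i powr (\<beta> - 1)) x (sample_adjoint K x \<theta>))
     + (real CARD('n) * \<gamma>) *\<^sub>R mat 1"

end

theory Submission
  imports Defs
begin

text \<open>Write \<open>f = \<Sum>i. a i * lam i powr (\<beta> / 2) * \<psi> i\<close> and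
  \<open>v j i = p i * lam i powr (\<beta> / 2) * \<psi> i (x j)\<close>. In the coefficients \<open>a\<close> the problem is ridge
  regression with square-summable features \<open>v j\<close>. Its regularized matrix is the Gram matrix of the
  features plus \<open>n \<gamma>\<close> times the identity, which is positive definite. If \<open>\<theta>\<close> solves the normal
  equations and \<open>a0 = \<Sum>j. \<theta>\<^sub>j v\<^sub>j\<close>, the objective at \<open>a\<close> exceeds that at \<open>a0\<close> by
  \<open>(1/n) * \<Sum>j. \<langle>v j, a - a0\<rangle>\<^sup>2 + \<gamma> * \<parallel>a - a0\<parallel>\<^sup>2\<close>, so \<open>a0\<close> is the unique minimizer. The
  Riesz-Fischer theorem turns \<open>a0\<close> back into a function.\<close>

section \<open>Square-integrable functions: inner product, Cauchy-Schwarz inequality and convergent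
  series\<close>

lemma abs_mult_le_sum_squares: "\<bar>a * b\<bar> \<le> a\<^sup>2 + b\<^sup>2" for a b :: real
proof -
  have "2 * \<bar>a * b\<bar> \<le> a\<^sup>2 + b\<^sup>2"
    using sum_squares_bound[of "\<bar>a\<bar>" "\<bar>b\<bar>"] by (simp add: abs_mult)
  then show ?thesis by (smt (verit) abs_ge_zero)
qed

lemma L2_mult_integrable:
  assumes "f \<in> L2_space M" "g \<in> L2_space M"
  shows "integrable M (\<lambda>t. f t * g t)"
proof (rule Bochner_Integration.integrable_bound)
  show "integrable M (\<lambda>t. (f t)\<^sup>2 + (g t)\<^sup>2)"
    using assms by (auto simp: L2_space_def)
  show "(\<lambda>t. f t * g t) \<in> borel_measurable M"
    using assms by (auto simp: L2_space_def)
  show "AE t in M. norm (f t * g t) \<le> norm ((f t)\<^sup>2 + (g t)\<^sup>2)"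
    using abs_mult_le_sum_squares by auto
qed

lemma L2_add:
  assumes "f \<in> L2_space M" "g \<in> L2_space M"
  shows "(\<lambda>t. f t + g t) \<in> L2_space M"
  using assms L2_mult_integrable[OF assms]
  by (auto simp: L2_space_def power2_sum mult.assoc)

lemma L2_cmult: "f \<in> L2_space M \<Longrightarrow> (\<lambda>t. c * f t) \<in> L2_space M"
  by (auto simp: L2_space_def power_mult_distrib)

lemma L2_diff:
  assumes "f \<in> L2_space M" "g \<in> L2_space M"
  shows "(\<lambda>t. f t - g t) \<in> L2_space M"
  using L2_add[OF assms(1) L2_cmult[OF assms(2), of "-1"]] by simp

lemma L2_sum: "(\<And>i. i \<in> A \<Longrightarrow> f i \<in> L2_space M) \<Longrightarrow> (\<lambda>t. \<Sum>i\<in>A. f i t) \<in> L2_space M"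
proof (induction A rule: infinite_finite_induct)
  case (insert i A)
  then show ?case using L2_add[of "f i" M "\<lambda>t. \<Sum>i\<in>A. f i t"] by simp
qed (auto simp: L2_space_def)

lemma L2_inner_commute: "L2_inner M f g = L2_inner M g f"
  by (simp add: L2_inner_def mult.commute)

lemma L2_inner_add_left:
  assumes "f \<in> L2_space M" "g \<in> L2_space M" "h \<in> L2_space M"
  shows "L2_inner M (\<lambda>t. f t + g t) h = L2_inner M f h + L2_inner M g h"
  unfolding L2_inner_def distrib_right
  by (intro Bochner_Integration.integral_add L2_mult_integrable assms)

lemma L2_inner_diff_left:
  assumes "f \<in> L2_space M" "g \<in> L2_space M" "h \<in> L2_space M"
  shows "L2_inner M (\<lambda>t. f t - g t) h = L2_inner M f h - L2_inner M g h"
  unfolding L2_inner_def left_diff_distrib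
  by (intro Bochner_Integration.integral_diff L2_mult_integrable assms)

lemma L2_inner_cmult_left: "L2_inner M (\<lambda>t. c * f t) h = c * L2_inner M f h"
  by (simp add: L2_inner_def mult.assoc)

lemma L2_inner_sum_left:
  assumes "\<And>i. i \<in> A \<Longrightarrow> f i \<in> L2_space M" "h \<in> L2_space M"
  shows "L2_inner M (\<lambda>t. \<Sum>i\<in>A. f i t) h = (\<Sum>i\<in>A. L2_inner M (f i) h)"
  unfolding L2_inner_def sum_distrib_right
  by (intro Bochner_Integration.integral_sum L2_mult_integrable assms)

lemma L2_inner_self_nonneg: "0 \<le> L2_inner M f f"
  by (simp add: L2_inner_def)

text \<open>The squared norm of \<open>f + s * g\<close> is a quadratic polynomial in
  \<open>s\<close> that is never negative; a good choice of \<open>s\<close> gives the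
  bound.\<close>

lemma L2_Cauchy_Schwarz:
  assumes f: "f \<in> L2_space M" and g: "g \<in> L2_space M"
  shows "\<bar>L2_inner M f g\<bar> \<le> L2_norm M f * L2_norm M g"
proof -
  let ?a = "L2_inner M f f" and ?b = "L2_inner M f g" and ?c = "L2_inner M g g"
  have q: "0 \<le> ?a + 2 * s * ?b + s\<^sup>2 * ?c" for s
  proof -
    have sg: "(\<lambda>t. s * g t) \<in> L2_space M" by (rule L2_cmult[OF g])
    have "0 \<le> L2_inner M (\<lambda>t. f t + s * g t) (\<lambda>t. f t + s * g t)"
      by (rule L2_inner_self_nonneg)
    also have "\<dots> = L2_inner M f (\<lambda>t. f t + s * g t) + s * L2_inner M g (\<lambda>t. f t + s * g t)"
      using L2_inner_add_left[OF f sg L2_add[OF f sg]] by (simp add: L2_inner_cmult_left)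
    also have "L2_inner M f (\<lambda>t. f t + s * g t) = ?a + s * ?b"
      using L2_inner_add_left[OF f sg f]
      by (simp add: L2_inner_cmult_left L2_inner_commute[of M f "\<lambda>t. f t + s * g t"]
          L2_inner_commute[of M g f])
    also have "L2_inner M g (\<lambda>t. f t + s * g t) = ?b + s * ?c"
      using L2_inner_add_left[OF f sg g]
      by (simp add: L2_inner_cmult_left L2_inner_commute[of M g "\<lambda>t. f t + s * g t"])
    finally show ?thesis by (simp add: algebra_simps power2_eq_square)
  qed
  have "?b\<^sup>2 \<le> ?a * ?c"
  proof (cases "?c = 0")
    case True
    have "?b = 0"
    proof (rule ccontr)
      assume "?b \<noteq> 0"
      \<comment> \<open>With \<open>?c = 0\<close> the polynomial is affine in \<open>s\<close>;
        this \<open>s\<close> gives it the value -1.\<close>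
      with q[of "- (?a + 1) / (2 * ?b)"] True show False
        by (simp add: field_simps)
    qed
    with True show ?thesis by simp
  next
    case False
    then have "?c > 0" using L2_inner_self_nonneg[of M g] by simp
    \<comment> \<open>This \<open>s\<close> is the minimizer; the minimum is
      \<open>?a - ?b\<^sup>2 / ?c\<close>.\<close>
    with q[of "- ?b / ?c"] show ?thesis
      by (simp add: field_simps power2_eq_square)
  qed
  then have "\<bar>?b\<bar> \<le> sqrt (?a * ?c)"
    using real_le_rsqrt by force
  then show ?thesis by (simp add: L2_norm_def real_sqrt_mult)
qed

lemma L2_inner_self_eq_0_iff:
  assumes "f \<in> L2_space M"
  shows "L2_inner M f f = 0 \<longleftrightarrow> (AE t in M. f t = 0)"
  using assms unfolding L2_inner_def power2_eq_square[symmetric]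
  by (subst integral_nonneg_eq_0_iff_AE) (auto simp: L2_space_def)

text \<open>The remainder norms are integrals and so ignore null sets. Membership of
  \<open>g\<close> in \<open>L2_space M\<close> is a separate premise because almost everywhere
  equality alone does not give measurability.\<close>

lemma L2_sums_cong_AE:
  assumes "L2_sums M u f" "g \<in> L2_space M" "AE t in M. g t = f t"
  shows "L2_sums M u g"
proof -
  have "(\<lambda>t. \<Sum>i<N. u i t) \<in> borel_measurable M" for N
    using assms by (intro borel_measurable_sum) (auto simp: L2_space_def L2_sums_def)
  then have "L2_norm M (\<lambda>t. g t - (\<Sum>i<N. u i t)) = L2_norm M (\<lambda>t. f t - (\<Sum>i<N. u i t))" for N
    unfolding L2_norm_def L2_inner_def
    using assms by (intro arg_cong[where f = sqrt] integral_cong_AE)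
      (auto simp: L2_space_def L2_sums_def)
  then show ?thesis using assms by (simp add: L2_sums_def)
qed

text \<open>Continuity of the inner product: by Cauchy-Schwarz the error after \<open>N\<close>
  terms is at most the norm of the remainder times the norm of \<open>h\<close>.\<close>

lemma L2_sums_inner:
  assumes "L2_sums M u f" "h \<in> L2_space M"
  shows "(\<lambda>i. L2_inner M (u i) h) sums L2_inner M f h"
proof -
  have f: "f \<in> L2_space M" and u: "\<And>i. u i \<in> L2_space M"
    and lim: "(\<lambda>N. L2_norm M (\<lambda>t. f t - (\<Sum>i<N. u i t))) \<longlonglongrightarrow> 0"
    using assms by (auto simp: L2_sums_def)
  have "(\<lambda>N. L2_inner M f h - (\<Sum>i<N. L2_inner M (u i) h)) \<longlonglongrightarrow> 0"
  proof (rule Lim_null_comparison[OF always_eventually])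
    show "\<forall>N. norm (L2_inner M f h - (\<Sum>i<N. L2_inner M (u i) h))
        \<le> L2_norm M (\<lambda>t. f t - (\<Sum>i<N. u i t)) * L2_norm M h"
    proof
      fix N
      have "L2_inner M f h - (\<Sum>i<N. L2_inner M (u i) h)
          = L2_inner M (\<lambda>t. f t - (\<Sum>i<N. u i t)) h"
        using f u assms(2) by (simp add: L2_inner_diff_left L2_inner_sum_left L2_sum)
      then show "norm (L2_inner M f h - (\<Sum>i<N. L2_inner M (u i) h))
          \<le> L2_norm M (\<lambda>t. f t - (\<Sum>i<N. u i t)) * L2_norm M h"
        using L2_Cauchy_Schwarz[OF L2_diff[OF f L2_sum] assms(2), of "{..<N}" u] u by simp
    qed
    show "(\<lambda>N. L2_norm M (\<lambda>t. f t - (\<Sum>i<N. u i t)) * L2_norm M h) \<longlonglongrightarrow> 0"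
      using tendsto_mult_right[OF lim, of "L2_norm M h"] by simp
  qed
  then show ?thesis
    unfolding sums_def using tendsto_diff[OF tendsto_const] by (fastforce intro: Lim_transform)
qed

section \<open>Orthonormal systems and the Riesz-Fischer theorem\<close>

locale L2_orthonormal =
  fixes M :: "'x measure" and \<psi> :: "nat \<Rightarrow> 'x \<Rightarrow> real"
  assumes basis_L2: "\<And>i. \<psi> i \<in> L2_space M"
    and inner_basis: "\<And>i k. L2_inner M (\<psi> i) (\<psi> k) = (if i = k then 1 else 0)"
begin

text \<open>Pairing the series termwise with \<open>\<psi> k\<close> leaves only the term of index
  \<open>k\<close>.\<close>

lemma L2_sums_coeff:
  assumes "L2_sums M (\<lambda>i t. c i * \<psi> i t) f"
  shows "L2_inner M f (\<psi> k) = c k"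
proof -
  have "(\<lambda>i. L2_inner M (\<lambda>t. c i * \<psi> i t) (\<psi> k)) sums L2_inner M f (\<psi> k)"
    by (rule L2_sums_inner[OF assms basis_L2])
  moreover have "(\<lambda>i. L2_inner M (\<lambda>t. c i * \<psi> i t) (\<psi> k)) = (\<lambda>i. if i = k then c i else 0)"
    by (auto simp: L2_inner_cmult_left inner_basis)
  ultimately show ?thesis
    using sums_single[of k c] sums_unique2 by metis
qed

lemma L2_inner_partial_sum:
  assumes "finite A"
  shows "L2_inner M (\<lambda>t. \<Sum>i\<in>A. c i * \<psi> i t) (\<lambda>t. \<Sum>i\<in>A. c i * \<psi> i t) = (\<Sum>i\<in>A. (c i)\<^sup>2)"
proof -
  have S: "(\<lambda>t. \<Sum>i\<in>A. c i * \<psi> i t) \<in> L2_space M"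
    by (intro L2_sum L2_cmult basis_L2)
  have "L2_inner M (\<psi> i) (\<lambda>t. \<Sum>k\<in>A. c k * \<psi> k t) = c i" if "i \<in> A" for i
    using that assms
    by (subst L2_inner_commute)
      (simp add: L2_inner_sum_left L2_cmult basis_L2 L2_inner_cmult_left inner_basis if_distrib
        cong: if_cong)
  then show ?thesis
    by (simp add: L2_inner_sum_left[OF L2_cmult[OF basis_L2] S] L2_inner_cmult_left power2_eq_square)
qed

text \<open>Pythagoras again, now as a nonnegative integral, the form that fits Fatou's lemma and
  the exchange of integral and series.\<close>

lemma nn_integral_partial_sum:
  assumes "finite A"
  shows "(\<integral>\<^sup>+t. ennreal ((\<Sum>i\<in>A. c i * \<psi> i t)\<^sup>2) \<partial>M) = ennreal (\<Sum>i\<in>A. (c i)\<^sup>2)"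
proof -
  have "(\<lambda>t. \<Sum>i\<in>A. c i * \<psi> i t) \<in> L2_space M"
    by (intro L2_sum L2_cmult basis_L2)
  then have "(\<integral>\<^sup>+t. ennreal ((\<Sum>i\<in>A. c i * \<psi> i t)\<^sup>2) \<partial>M)
      = ennreal (\<integral>t. (\<Sum>i\<in>A. c i * \<psi> i t)\<^sup>2 \<partial>M)"
    by (intro nn_integral_eq_integral) (auto simp: L2_space_def)
  with L2_inner_partial_sum[OF assms, of c] show ?thesis
    by (simp add: L2_inner_def power2_eq_square)
qed

text \<open>Fatou's lemma identifies an almost everywhere limit along a subsequence with the \<open>L\<^sup>2\<close> sum.\<close>

lemma L2_sums_AE_limit:
  assumes sc: "summable (\<lambda>i. (c i)\<^sup>2)" and f: "f \<in> borel_measurable M"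
    and r: "filterlim r at_top sequentially"
    and lim: "AE t in M. (\<lambda>k. \<Sum>i<r k. c i * \<psi> i t) \<longlonglongrightarrow> f t"
  shows "L2_sums M (\<lambda>i t. c i * \<psi> i t) f"
proof -
  define S where "S N t = (\<Sum>i<N. c i * \<psi> i t)" for N t
  \<comment> \<open>The tail of the coefficient series, which will bound the squared distance from
    \<open>f\<close> to \<open>S N\<close>.\<close>
  define B where "B N = suminf (\<lambda>i. (c i)\<^sup>2) - (\<Sum>i<N. (c i)\<^sup>2)" for N
  have S: "S N \<in> L2_space M" for N
    unfolding S_def by (intro L2_sum L2_cmult basis_L2)
  have Sm [measurable]: "S N \<in> borel_measurable M" for N
    using S[of N] by (simp add: L2_space_def)
  note f [measurable]
  have fatou: "(\<integral>\<^sup>+t. ennreal ((f t - S N t)\<^sup>2) \<partial>M) \<le> ennreal (B N)" for N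
  proof -
    have "(\<integral>\<^sup>+t. ennreal ((f t - S N t)\<^sup>2) \<partial>M)
        = (\<integral>\<^sup>+t. liminf (\<lambda>k. ennreal ((S (r k) t - S N t)\<^sup>2)) \<partial>M)"
    proof (rule nn_integral_cong_AE, use lim in eventually_elim)
      fix t assume "(\<lambda>k. \<Sum>i<r k. c i * \<psi> i t) \<longlonglongrightarrow> f t"
      then have "(\<lambda>k. ennreal ((S (r k) t - S N t)\<^sup>2)) \<longlonglongrightarrow> ennreal ((f t - S N t)\<^sup>2)"
        unfolding S_def by (intro tendsto_intros)
      then show "ennreal ((f t - S N t)\<^sup>2) = liminf (\<lambda>k. ennreal ((S (r k) t - S N t)\<^sup>2))"
        using lim_imp_Liminf[OF sequentially_bot] by metis
    qed
    also have "\<dots> \<le> liminf (\<lambda>k. \<integral>\<^sup>+t. ennreal ((S (r k) t - S N t)\<^sup>2) \<partial>M)"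
      by (intro nn_integral_liminf) measurable
    also have "\<dots> \<le> ennreal (B N)"
    proof (rule Liminf_le)
      \<comment> \<open>Once \<open>r k \<ge> N\<close>, the difference \<open>S (r k) - S N\<close>
        is the block of terms from \<open>N\<close> to \<open>r k\<close>, whose squared norm is a
        piece of the tail \<open>B N\<close>.\<close>
      have "eventually (\<lambda>k. r k \<ge> N) sequentially"
        using r by (simp add: filterlim_at_top)
      then show "eventually (\<lambda>k. (\<integral>\<^sup>+t. ennreal ((S (r k) t - S N t)\<^sup>2) \<partial>M) \<le> ennreal (B N))
          sequentially"
      proof eventually_elim
        fix k assume k: "N \<le> r k"
        have split: "(\<Sum>i<r k. g i) - (\<Sum>i<N. g i) = (\<Sum>i\<in>{N..<r k}. g i)" for g :: "nat \<Rightarrow> real"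
          using sum_diff_nat_ivl[of 0 N "r k" g] k by (simp add: atLeast0LessThan)
        have "(\<integral>\<^sup>+t. ennreal ((S (r k) t - S N t)\<^sup>2) \<partial>M) = ennreal (\<Sum>i\<in>{N..<r k}. (c i)\<^sup>2)"
          unfolding S_def split by (rule nn_integral_partial_sum) simp
        also have "\<dots> \<le> ennreal (B N)"
          unfolding split[symmetric] B_def
          using sum_le_suminf[OF sc, of "{..<r k}"] by (intro ennreal_leI) auto
        finally show "(\<integral>\<^sup>+t. ennreal ((S (r k) t - S N t)\<^sup>2) \<partial>M) \<le> ennreal (B N)" .
      qed
    qed simp
    finally show ?thesis .
  qed
  have B0: "0 \<le> B N" for N
    using sum_le_suminf[OF sc, of "{..<N}"] by (simp add: B_def)
  have fS: "(\<lambda>t. f t - S N t) \<in> L2_space M" for N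
  proof -
    have "integrable M (\<lambda>t. (f t - S N t)\<^sup>2)"
      using fatou[of N] by (intro integrableI_nonneg) (auto intro: le_less_trans)
    then show ?thesis by (simp add: L2_space_def)
  qed
  have fL: "f \<in> L2_space M"
    \<comment> \<open>\<open>S 0\<close> is the zero function.\<close>
    using fS[of 0] by (simp add: S_def)
  have le: "L2_norm M (\<lambda>t. f t - S N t) \<le> sqrt (B N)" for N
  proof -
    have "integrable M (\<lambda>t. (f t - S N t)\<^sup>2)" using fS[of N] by (simp add: L2_space_def)
    then have "ennreal (\<integral>t. (f t - S N t)\<^sup>2 \<partial>M) \<le> ennreal (B N)"
      using fatou[of N] by (subst nn_integral_eq_integral[symmetric]) auto
    then show ?thesis
      using B0[of N] by (simp add: L2_norm_def L2_inner_def power2_eq_square)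
  qed
  have "B \<longlonglongrightarrow> 0"
    unfolding B_def using tendsto_diff[OF tendsto_const[of "\<Sum>i. (c i)\<^sup>2"] summable_LIMSEQ[OF sc]] by simp
  then have "(\<lambda>N. sqrt (B N)) \<longlonglongrightarrow> 0"
    using tendsto_real_sqrt by fastforce
  then have "(\<lambda>N. L2_norm M (\<lambda>t. f t - S N t)) \<longlonglongrightarrow> 0"
  proof (rule Lim_null_comparison[rotated], intro always_eventually allI)
    fix N show "norm (L2_norm M (\<lambda>t. f t - S N t)) \<le> sqrt (B N)"
      using le[of N] by (simp add: L2_norm_def L2_inner_self_nonneg)
  qed
  with fL show ?thesis
    unfolding L2_sums_def S_def by (auto intro: L2_cmult basis_L2)
qed

text \<open>Along a subsequence whose blocks \<open>d k\<close> have squared norm at most \<open>(1/4)^k\<close>, the weighted sum of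
  \<open>2^k * (d k)\<^sup>2\<close> is integrable, hence finite almost everywhere, and it dominates the sum of
  \<open>\<bar>d k\<bar>\<close> up to a geometric series.\<close>

theorem Riesz_Fischer:
  assumes sc: "summable (\<lambda>i. (c i)\<^sup>2)"
  obtains f where "L2_sums M (\<lambda>i t. c i * \<psi> i t) f"
proof -
  \<comment> \<open>The Cauchy criterion, with \<open>n \<ge> k\<close> added so that the chosen
    indices tend to infinity.\<close>
  have "\<forall>k. \<exists>n. n \<ge> k \<and> (\<forall>m\<ge>n. \<forall>l. \<bar>\<Sum>i\<in>{m..<l}. (c i)\<^sup>2\<bar> < (1/4) ^ k)"
  proof
    fix k :: nat
    obtain n where n: "\<forall>m\<ge>n. \<forall>l. norm (\<Sum>i\<in>{m..<l}. (c i)\<^sup>2) < (1/4) ^ k"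
      using sc[unfolded summable_Cauchy, rule_format, of "(1/4) ^ k"] by auto
    show "\<exists>n. n \<ge> k \<and> (\<forall>m\<ge>n. \<forall>l. \<bar>\<Sum>i\<in>{m..<l}. (c i)\<^sup>2\<bar> < (1/4) ^ k)"
      by (rule exI[of _ "max n k"]) (use n in auto)
  qed
  then obtain s where s: "\<And>k. s k \<ge> k"
    and s_small: "\<And>k m l. m \<ge> s k \<Longrightarrow> \<bar>\<Sum>i\<in>{m..<l}. (c i)\<^sup>2\<bar> < (1/4) ^ k"
    by metis
  \<comment> \<open>Cumulative sums make the index sequence monotone and keep it above
    \<open>s\<close>. Blocks between consecutive indices may be empty.\<close>
  define r where "r k = (\<Sum>j\<le>k. s j)" for k
  have r_Suc: "r k \<le> r (Suc k)" and sr: "s k \<le> r k" for k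
    by (auto simp: r_def intro: member_le_sum)
  have r_top: "filterlim r at_top sequentially"
    by (rule filterlim_at_top_mono[OF filterlim_ident always_eventually])
      (use s sr order_trans in blast)
  define S where "S N t = (\<Sum>i<N. c i * \<psi> i t)" for N t
  define d where "d k t = S (r (Suc k)) t - S (r k) t" for k t
  have Sm [measurable]: "S N \<in> borel_measurable M" for N
  proof -
    have "S N \<in> L2_space M"
      unfolding S_def by (intro L2_sum L2_cmult basis_L2)
    then show ?thesis by (simp add: L2_space_def)
  qed
  have dm [measurable]: "d k \<in> borel_measurable M" for k
    unfolding d_def by measurable
  have int_d: "(\<integral>\<^sup>+t. ennreal ((d k t)\<^sup>2) \<partial>M) \<le> ennreal ((1/4) ^ k)" for k
  proof -
    have "d k t = (\<Sum>i\<in>{r k..<r (Suc k)}. c i * \<psi> i t)" for t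
      using sum_diff_nat_ivl[of 0 "r k" "r (Suc k)" "\<lambda>i. c i * \<psi> i t"] r_Suc[of k]
      by (simp add: d_def S_def atLeast0LessThan)
    then show ?thesis
      using nn_integral_partial_sum[of "{r k..<r (Suc k)}" c] s_small[OF sr, of k "r (Suc k)"]
      by (auto intro!: ennreal_leI)
  qed
  have "(\<integral>\<^sup>+t. (\<Sum>k. ennreal (2 ^ k * (d k t)\<^sup>2)) \<partial>M) = (\<Sum>k. \<integral>\<^sup>+t. ennreal (2 ^ k * (d k t)\<^sup>2) \<partial>M)"
    by (intro nn_integral_suminf) measurable
  also have "\<dots> \<le> (\<Sum>k. ennreal ((1/2) ^ k))"
  proof (intro suminf_le summableI)
    fix k
    have "(\<integral>\<^sup>+t. ennreal (2 ^ k * (d k t)\<^sup>2) \<partial>M) = ennreal (2 ^ k) * (\<integral>\<^sup>+t. ennreal ((d k t)\<^sup>2) \<partial>M)"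
      by (simp add: ennreal_mult nn_integral_cmult)
    also have "\<dots> \<le> ennreal (2 ^ k) * ennreal ((1/4) ^ k)"
      by (intro mult_left_mono int_d) simp
    also have "\<dots> = ennreal ((1/2) ^ k)"
      by (simp add: ennreal_mult[symmetric] power_mult_distrib[symmetric])
    finally show "(\<integral>\<^sup>+t. ennreal (2 ^ k * (d k t)\<^sup>2) \<partial>M) \<le> ennreal ((1/2) ^ k)" .
  qed
  also have "\<dots> < \<infinity>"
    by (subst suminf_ennreal2) (auto simp: summable_geometric)
  finally have "AE t in M. (\<Sum>k. ennreal (2 ^ k * (d k t)\<^sup>2)) \<noteq> \<infinity>"
    by (intro nn_integral_PInf_AE) auto
  then have "AE t in M. convergent (\<lambda>k. S (r k) t)"
  proof eventually_elim
    fix t assume "(\<Sum>k. ennreal (2 ^ k * (d k t)\<^sup>2)) \<noteq> \<infinity>"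
    then have 1: "summable (\<lambda>k. 2 ^ k * (d k t)\<^sup>2)"
      by (intro summable_suminf_not_top) auto
    have "summable (\<lambda>k. d k t)"
    proof (rule summable_comparison_test)
      show "summable (\<lambda>k. (1/2::real) ^ k + 2 ^ k * (d k t)\<^sup>2)"
        by (intro summable_add 1 summable_geometric) simp
      \<comment> \<open>If \<open>\<bar>d k t\<bar>\<close> exceeds \<open>(1/2) ^ k\<close>, then
        \<open>2 ^ k * \<bar>d k t\<bar> \<ge> 1\<close>, and multiplying by
        \<open>\<bar>d k t\<bar>\<close> gives the second summand as a bound.\<close>
      have "\<bar>d k t\<bar> \<le> (1/2) ^ k + 2 ^ k * (d k t)\<^sup>2" for k
      proof (cases "\<bar>d k t\<bar> \<le> (1/2) ^ k")
        case True then show ?thesis by (simp add: add_increasing2)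
      next
        case False
        then have "1 \<le> 2 ^ k * \<bar>d k t\<bar>" by (simp add: field_simps)
        then have "1 * \<bar>d k t\<bar> \<le> 2 ^ k * \<bar>d k t\<bar> * \<bar>d k t\<bar>" by (intro mult_right_mono) auto
        also have "\<dots> = 2 ^ k * (d k t)\<^sup>2" by (simp add: power2_eq_square mult.assoc)
        finally show ?thesis by (simp add: add_increasing)
      qed
      then show "\<exists>N. \<forall>n\<ge>N. norm (d n t) \<le> (1/2) ^ n + 2 ^ n * (d n t)\<^sup>2"
        by auto
    qed
    then have "convergent (\<lambda>n. \<Sum>k<n. d k t)" by (simp add: summable_iff_convergent)
    moreover have "(\<Sum>k<n. d k t) = S (r n) t - S (r 0) t" for n
      unfolding d_def by (rule sum_lessThan_telescope)
    ultimately show "convergent (\<lambda>k. S (r k) t)"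
      using convergent_diff_const_right_iff[of "\<lambda>k. S (r k) t" "S (r 0) t"] by simp
  qed
  then have "AE t in M. (\<lambda>k. S (r k) t) \<longlonglongrightarrow> lim (\<lambda>k. S (r k) t)"
    by (simp add: convergent_LIMSEQ_iff)
  \<comment> \<open>Where the sequence diverges, which happens only on a null set,
    \<open>lim\<close> returns a fixed default value.\<close>
  moreover have "(\<lambda>t. lim (\<lambda>k. S (r k) t)) \<in> borel_measurable M"
    by measurable
  ultimately have "L2_sums M (\<lambda>i t. c i * \<psi> i t) (\<lambda>t. lim (\<lambda>k. S (r k) t))"
    by (intro L2_sums_AE_limit[OF sc _ r_top]) (auto simp: S_def)
  then show thesis by (rule that)
qed

end

text \<open>Both sums have the same inner product with their difference, since it is computed from
  the same terms; hence the difference has norm zero.\<close>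

lemma L2_sums_unique_AE:
  assumes "L2_sums M u f" "L2_sums M u g"
  shows "AE t in M. f t = g t"
proof -
  let ?h = "\<lambda>t. f t - g t"
  have f: "f \<in> L2_space M" and g: "g \<in> L2_space M"
    using assms by (auto simp: L2_sums_def)
  have h: "?h \<in> L2_space M" by (rule L2_diff[OF f g])
  have "L2_inner M f ?h = L2_inner M g ?h"
    using L2_sums_inner[OF assms(1) h] L2_sums_inner[OF assms(2) h] by (rule sums_unique2)
  then have "L2_inner M ?h ?h = 0"
    by (simp add: L2_inner_diff_left[OF f g h])
  then show ?thesis
    by (simp add: L2_inner_self_eq_0_iff[OF h])
qed

subsection \<open>Ridge regression in the space of square-summable sequences\<close>

definition l2_inner :: "(nat \<Rightarrow> real) \<Rightarrow> (nat \<Rightarrow> real) \<Rightarrow> real" where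
  "l2_inner a b = (\<Sum>i. a i * b i)"

definition l2_seq :: "(nat \<Rightarrow> real) \<Rightarrow> bool" where
  "l2_seq a \<longleftrightarrow> summable (\<lambda>i. (a i)\<^sup>2)"

lemma l2_seq_summable_mult:
  assumes "l2_seq a" "l2_seq b"
  shows "summable (\<lambda>i. a i * b i)"
proof (rule summable_comparison_test)
  show "summable (\<lambda>i. (a i)\<^sup>2 + (b i)\<^sup>2)"
    using assms by (auto simp: l2_seq_def intro: summable_add)
  have "norm (a i * b i) \<le> (a i)\<^sup>2 + (b i)\<^sup>2" for i
    using abs_mult_le_sum_squares by simp
  then show "\<exists>N. \<forall>n\<ge>N. norm (a n * b n) \<le> (a n)\<^sup>2 + (b n)\<^sup>2" by blast
qed

lemma l2_seq_cmult: "l2_seq a \<Longrightarrow> l2_seq (\<lambda>i. c * a i)"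
  by (simp add: l2_seq_def power_mult_distrib summable_mult)

lemma l2_seq_add:
  assumes "l2_seq a" "l2_seq b"
  shows "l2_seq (\<lambda>i. a i + b i)"
proof -
  have "summable (\<lambda>i. (a i)\<^sup>2 + (b i)\<^sup>2 + 2 * (a i * b i))"
    using assms l2_seq_summable_mult[OF assms]
    by (intro summable_add summable_mult) (auto simp: l2_seq_def)
  then show ?thesis by (simp add: l2_seq_def power2_sum mult.assoc)
qed

lemma l2_seq_diff:
  assumes "l2_seq a" "l2_seq b"
  shows "l2_seq (\<lambda>i. a i - b i)"
  using l2_seq_add[OF assms(1) l2_seq_cmult[OF assms(2), of "-1"]] by simp

lemma l2_seq_sum: "(\<And>j. j \<in> A \<Longrightarrow> l2_seq (f j)) \<Longrightarrow> l2_seq (\<lambda>i. \<Sum>j\<in>A. f j i)"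
proof (induction A rule: infinite_finite_induct)
  case (insert j A)
  then show ?case using l2_seq_add[of "f j" "\<lambda>i. \<Sum>j\<in>A. f j i"] by simp
qed (auto simp: l2_seq_def)

lemma l2_inner_commute: "l2_inner a b = l2_inner b a"
  by (simp add: l2_inner_def mult.commute)

lemma l2_inner_add_left:
  assumes "l2_seq a" "l2_seq b" "l2_seq c"
  shows "l2_inner (\<lambda>i. a i + b i) c = l2_inner a c + l2_inner b c"
  unfolding l2_inner_def distrib_right
  by (intro suminf_add[symmetric] l2_seq_summable_mult assms)

lemma l2_inner_add_right:
  assumes "l2_seq a" "l2_seq b" "l2_seq c"
  shows "l2_inner c (\<lambda>i. a i + b i) = l2_inner c a + l2_inner c b"
  using l2_inner_add_left[OF assms] by (simp add: l2_inner_commute)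

lemma l2_inner_lincomb_left:
  assumes "\<And>j. j \<in> A \<Longrightarrow> l2_seq (v j)" "l2_seq b"
  shows "l2_inner (\<lambda>i. \<Sum>j\<in>A. c j * v j i) b = (\<Sum>j\<in>A. c j * l2_inner (v j) b)"
proof -
  have *: "summable (\<lambda>i. v j i * b i)" if "j \<in> A" for j
    using that by (intro l2_seq_summable_mult assms)
  have "l2_inner (\<lambda>i. \<Sum>j\<in>A. c j * v j i) b = (\<Sum>i. \<Sum>j\<in>A. c j * (v j i * b i))"
    by (simp add: l2_inner_def sum_distrib_right mult.assoc)
  also have "\<dots> = (\<Sum>j\<in>A. \<Sum>i. c j * (v j i * b i))"
    by (intro suminf_sum summable_mult *)
  also have "\<dots> = (\<Sum>j\<in>A. c j * l2_inner (v j) b)"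
    unfolding l2_inner_def by (intro sum.cong refl suminf_mult *)
  finally show ?thesis .
qed

lemma l2_inner_self_nonneg: "l2_seq a \<Longrightarrow> 0 \<le> l2_inner a a"
  by (simp add: l2_inner_def l2_seq_def suminf_nonneg flip: power2_eq_square)

lemma l2_inner_self_eq_0:
  assumes "l2_seq a" "l2_inner a a = 0"
  shows "a i = 0"
  using assms suminf_eq_zero_iff[of "\<lambda>i. (a i)\<^sup>2"]
  by (simp add: l2_inner_def l2_seq_def power2_eq_square)

text \<open>With the features of the application, this is the operator \<open>S\<^sub>n \<A>\<close>
  acting on the coefficients of a function in \<open>Hpow\<close>.\<close>

definition l2_sample :: "('n::finite \<Rightarrow> nat \<Rightarrow> real) \<Rightarrow> (nat \<Rightarrow> real) \<Rightarrow> real ^ 'n" where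
  "l2_sample v a = (\<chi> j. l2_inner (v j) a)"

definition l2_adjoint :: "('n::finite \<Rightarrow> nat \<Rightarrow> real) \<Rightarrow> real ^ 'n \<Rightarrow> nat \<Rightarrow> real" where
  "l2_adjoint v \<theta> = (\<lambda>i. \<Sum>j\<in>UNIV. \<theta> $ j * v j i)"

definition l2_gram :: "('n::finite \<Rightarrow> nat \<Rightarrow> real) \<Rightarrow> real ^ 'n ^ 'n" where
  "l2_gram v = (\<chi> j l. l2_inner (v j) (v l))"

definition ridge_objective ::
  "('n::finite \<Rightarrow> nat \<Rightarrow> real) \<Rightarrow> real \<Rightarrow> real ^ 'n \<Rightarrow> (nat \<Rightarrow> real) \<Rightarrow> real" where
  "ridge_objective v \<gamma> y a =
     1 / real CARD('n) * (norm (l2_sample v a - y))\<^sup>2 + \<gamma> * l2_inner a a"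

lemma l2_seq_adjoint: "(\<And>j. l2_seq (v j)) \<Longrightarrow> l2_seq (l2_adjoint v \<theta>)"
  unfolding l2_adjoint_def by (intro l2_seq_sum l2_seq_cmult)

lemma l2_inner_adjoint:
  assumes "\<And>j. l2_seq (v j)" "l2_seq b"
  shows "l2_inner (l2_adjoint v \<theta>) b = \<theta> \<bullet> l2_sample v b"
  using assms by (simp add: l2_adjoint_def l2_inner_lincomb_left l2_sample_def inner_vec_def)

text \<open>Adjointness applied to \<open>b = v j\<close>, together with symmetry of the inner
  product. This makes the problem finite-dimensional.\<close>

lemma l2_sample_adjoint:
  assumes "\<And>j. l2_seq (v j)"
  shows "l2_sample v (l2_adjoint v \<theta>) = l2_gram v *v \<theta>"
proof -
  have "l2_inner (v j) (l2_adjoint v \<theta>) = (\<Sum>l\<in>UNIV. l2_inner (v j) (v l) * \<theta> $ l)" for j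
    using l2_inner_adjoint[OF assms assms, where \<theta> = \<theta>]
    by (simp add: l2_inner_commute[of "v j"] l2_sample_def inner_vec_def mult.commute)
  then show ?thesis
    by (simp add: l2_sample_def l2_gram_def matrix_vector_mult_def)
qed

lemma scaleR_mat_1_mult_vec: "(c *\<^sub>R mat 1) *v \<theta> = c *\<^sub>R (\<theta> :: real ^ 'n)"
  by (simp flip: scaleR_matrix_vector_assoc)

text \<open>The Gram form at \<open>\<theta>\<close> is the squared norm of
  \<open>l2_adjoint v \<theta>\<close>, hence nonnegative. A vector in the kernel therefore
  satisfies \<open>c * (\<theta> \<bullet> \<theta>) \<le> 0\<close>.\<close>

lemma invertible_gram_plus_mat:
  fixes v :: "'n::finite \<Rightarrow> nat \<Rightarrow> real"
  assumes v: "\<And>j. l2_seq (v j)" and c: "c > 0"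
  shows "invertible (l2_gram v + c *\<^sub>R mat 1)"
  unfolding invertible_left_inverse matrix_left_invertible_ker
proof (intro allI impI)
  fix \<theta> :: "real ^ 'n"
  assume "(l2_gram v + c *\<^sub>R mat 1) *v \<theta> = 0"
  then have "\<theta> \<bullet> (l2_gram v *v \<theta> + c *\<^sub>R \<theta>) = 0"
    by (simp add: matrix_vector_mult_add_rdistrib scaleR_mat_1_mult_vec)
  moreover have "\<theta> \<bullet> (l2_gram v *v \<theta>) \<ge> 0"
  proof -
    have a: "l2_seq (l2_adjoint v \<theta>)" by (rule l2_seq_adjoint[OF v])
    show ?thesis
      using l2_inner_self_nonneg[OF a]
      by (simp add: l2_inner_adjoint[OF v a] l2_sample_adjoint[OF v])
  qed
  ultimately have "c * (\<theta> \<bullet> \<theta>) \<le> 0" by (simp add: inner_add_right)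
  then have "\<theta> \<bullet> \<theta> \<le> 0" using c by (simp add: mult_le_0_iff)
  then have "\<theta> \<bullet> \<theta> = 0" using inner_ge_zero[of \<theta>] by (rule order_antisym)
  then show "\<theta> = 0" by simp
qed

text \<open>Both quadratic terms are expanded around \<open>a0\<close>. The normal equations make
  the cross term of the data fit cancel the cross term of the penalty.\<close>

lemma ridge_objective_decomposition:
  fixes v :: "'n::finite \<Rightarrow> nat \<Rightarrow> real"
  assumes v: "\<And>j. l2_seq (v j)" and a: "l2_seq a"
    and normal: "(l2_gram v + (real CARD('n) * \<gamma>) *\<^sub>R mat 1) *v \<theta> = y"
  defines "a0 \<equiv> l2_adjoint v \<theta>"
  defines "d \<equiv> \<lambda>i. a i - a0 i"
  shows "ridge_objective v \<gamma> y a = ridge_objective v \<gamma> y a0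
    + 1 / real CARD('n) * (norm (l2_sample v d))\<^sup>2 + \<gamma> * l2_inner d d"
proof -
  have a0: "l2_seq a0" unfolding a0_def by (rule l2_seq_adjoint[OF v])
  have d: "l2_seq d" unfolding d_def by (rule l2_seq_diff[OF a a0])
  have a_eq: "a = (\<lambda>i. a0 i + d i)" by (simp add: d_def)
  define n where "n = real CARD('n)"
  have n: "n > 0" by (simp add: n_def)
  \<comment> \<open>The normal equations read as a formula for the residual: it is a multiple of
    \<open>\<theta>\<close>, so adjointness turns its product with \<open>l2_sample v d\<close> into
    \<open>l2_inner a0 d\<close>.\<close>
  have res: "l2_sample v a0 - y = - (n * \<gamma>) *\<^sub>R \<theta>"
    using normal l2_sample_adjoint[OF v, where \<theta> = \<theta>]
    by (simp add: a0_def n_def scaleR_mat_1_mult_vec algebra_simps)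
  have "l2_sample v a = l2_sample v a0 + l2_sample v d"
    by (simp add: vec_eq_iff l2_sample_def a_eq l2_inner_add_right[OF a0 d v])
  then have "l2_sample v a - y = (l2_sample v a0 - y) + l2_sample v d"
    by simp
  then have 1: "(norm (l2_sample v a - y))\<^sup>2 = (norm (l2_sample v a0 - y))\<^sup>2
      + 2 * ((l2_sample v a0 - y) \<bullet> l2_sample v d) + (norm (l2_sample v d))\<^sup>2"
    by (simp only: power2_norm_eq_inner inner_add_left inner_add_right)
      (simp add: inner_commute)
  have 2: "(l2_sample v a0 - y) \<bullet> l2_sample v d = - (n * \<gamma>) * l2_inner a0 d"
    unfolding res by (simp add: a0_def l2_inner_adjoint[OF v d])
  have 3: "l2_inner a a = l2_inner a0 a0 + 2 * l2_inner a0 d + l2_inner d d"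
    unfolding a_eq
    by (simp add: l2_inner_add_left[OF a0 d l2_seq_add[OF a0 d]] l2_inner_add_right[OF a0 d]
        a0 d l2_inner_commute[of d a0])
  show ?thesis
    unfolding ridge_objective_def n_def[symmetric] 1 2 3
    using n by (simp add: field_simps)
qed

subsection \<open>Coefficients in the eigenbasis\<close>

context L2_orthonormal
begin

lemma Hpow_rep_coeff:
  assumes "Hpow_rep M lam \<psi> \<beta> a f"
  shows "L2_inner M f (\<psi> i) = a i * lam i powr (\<beta> / 2)"
  using assms L2_sums_coeff[of "\<lambda>i. a i * lam i powr (\<beta> / 2)"] by (simp add: Hpow_rep_def)

lemma Hpow_rep_unique:
  assumes "Hpow_rep M lam \<psi> \<beta> a f" "Hpow_rep M lam \<psi> \<beta> b f" "\<And>i. lam i > 0"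
  shows "a = b"
proof
  fix i
  have "lam i powr (\<beta> / 2) \<noteq> 0"
    using assms(3)[of i] by simp
  then show "a i = b i"
    using Hpow_rep_coeff[OF assms(1), of i] Hpow_rep_coeff[OF assms(2), of i] by simp
qed

text \<open>Uniqueness of the coefficients evaluates the \<open>THE\<close> in the norm.\<close>

lemma Hpow_norm_eq:
  assumes "Hpow_rep M lam \<psi> \<beta> a f" "\<And>i. lam i > 0"
  shows "(Hpow_norm M lam \<psi> \<beta> f)\<^sup>2 = l2_inner a a"
proof -
  have "(THE a. Hpow_rep M lam \<psi> \<beta> a f) = a"
    using assms Hpow_rep_unique by blast
  moreover have "0 \<le> (\<Sum>i. (a i)\<^sup>2)"
    using assms(1) by (simp add: Hpow_rep_def suminf_nonneg)
  ultimately show ?thesis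
    by (simp add: Hpow_norm_def l2_inner_def power2_eq_square)
qed

text \<open>The factor \<open>lam i powr (\<beta> / 2)\<close> moves from the coefficients of
  \<open>f\<close> into the features, so that the penalty becomes the plain squared norm of
  \<open>a\<close>.\<close>

lemma rls_objective_eq_ridge:
  assumes "Hpow_rep M lam \<psi> \<beta> a f" "\<And>i. lam i > 0"
  shows "rls_objective M lam \<psi> p \<beta> \<gamma> x y f
    = ridge_objective (\<lambda>j i. p i * lam i powr (\<beta> / 2) * \<psi> i (x j)) \<gamma> y a"
proof -
  have "sample_spectral M \<psi> p x f = l2_sample (\<lambda>j i. p i * lam i powr (\<beta> / 2) * \<psi> i (x j)) a"
    by (simp add: sample_spectral_def l2_sample_def l2_inner_def Hpow_rep_coeff[OF assms(1)]
        mult_ac)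
  then show ?thesis
    by (simp add: rls_objective_def ridge_objective_def Hpow_norm_eq[OF assms])
qed

text \<open>If \<open>C\<close> bounds \<open>lam\<close>, the squared coefficients are at most
  \<open>C\<close> times the terms of the series for \<open>K s s\<close>. The pointwise expansion
  then converges in the mean as well.\<close>

lemma kernel_section_L2_sums:
  assumes K: "\<And>s t. s \<in> space M \<Longrightarrow> t \<in> space M \<Longrightarrow> (\<lambda>i. lam i * \<psi> i s * \<psi> i t) sums K s t"
    and lam: "\<And>i. lam i > 0" "bdd_above (range lam)" and s: "s \<in> space M"
  shows "L2_sums M (\<lambda>i t. lam i * \<psi> i s * \<psi> i t) (K s)"
\<comment> \<open>The whole sequence of partial sums converges pointwise, so the subsequence is the
  identity.\<close>
proof (rule L2_sums_AE_limit[OF _ _ filterlim_ident])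
  obtain C where C: "\<And>i. lam i \<le> C" using lam(2) by (auto simp: bdd_above_def)
  show "summable (\<lambda>i. (lam i * \<psi> i s)\<^sup>2)"
  proof (rule summable_comparison_test)
    show "summable (\<lambda>i. C * (lam i * \<psi> i s * \<psi> i s))"
      using K[OF s s] by (intro summable_mult) (rule sums_summable)
    have "(lam i * \<psi> i s)\<^sup>2 \<le> C * (lam i * \<psi> i s * \<psi> i s)" for i
      using mult_right_mono[OF C[of i], of "lam i * (\<psi> i s)\<^sup>2"] lam(1)[of i]
      by (simp add: power2_eq_square mult_ac)
    then show "\<exists>N. \<forall>n\<ge>N. norm ((lam n * \<psi> n s)\<^sup>2) \<le> C * (lam n * \<psi> n s * \<psi> n s)"
      by simp
  qed
  have lim: "(\<lambda>N. \<Sum>i<N. lam i * \<psi> i s * \<psi> i t) \<longlonglongrightarrow> K s t" if "t \<in> space M" for t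
    using K[OF s that] by (simp add: sums_def)
  then show "AE t in M. (\<lambda>N. \<Sum>i<N. lam i * \<psi> i s * \<psi> i t) \<longlonglongrightarrow> K s t"
    by simp
  show "K s \<in> borel_measurable M"
  proof (rule borel_measurable_LIMSEQ_real[OF lim])
    fix N
    have "(\<lambda>t. \<Sum>i<N. lam i * \<psi> i s * \<psi> i t) \<in> L2_space M"
      by (intro L2_sum L2_cmult basis_L2)
    then show "(\<lambda>t. \<Sum>i<N. lam i * \<psi> i s * \<psi> i t) \<in> borel_measurable M"
      by (simp add: L2_space_def)
  qed
qed

text \<open>The factor \<open>lam i\<close> in these coefficients is what later raises
  \<open>lam i powr (\<beta> - 1)\<close> to the power \<open>\<beta>\<close>.\<close>

lemma
  assumes K: "\<And>s t. s \<in> space M \<Longrightarrow> t \<in> space M \<Longrightarrow> (\<lambda>i. lam i * \<psi> i s * \<psi> i t) sums K s t"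
    and lam: "\<And>i. lam i > 0" "bdd_above (range lam)" and x: "\<And>j. x j \<in> space M"
  shows sample_adjoint_L2: "sample_adjoint K x \<theta> \<in> L2_space M"
    and sample_adjoint_coeff: "L2_inner M (sample_adjoint K x \<theta>) (\<psi> i)
      = lam i * (\<Sum>j\<in>UNIV. \<theta> $ j * \<psi> i (x j))"
proof -
  have sums: "L2_sums M (\<lambda>i t. lam i * \<psi> i (x j) * \<psi> i t) (K (x j))" for j
    by (rule kernel_section_L2_sums[OF K lam x])
  then have L2: "K (x j) \<in> L2_space M" for j
    by (simp add: L2_sums_def)
  have coeff: "L2_inner M (K (x j)) (\<psi> i) = lam i * \<psi> i (x j)" for j
    using L2_sums_coeff[OF sums] .
  show "sample_adjoint K x \<theta> \<in> L2_space M"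
    unfolding sample_adjoint_def by (intro L2_sum L2_cmult L2)
  show "L2_inner M (sample_adjoint K x \<theta>) (\<psi> i) = lam i * (\<Sum>j\<in>UNIV. \<theta> $ j * \<psi> i (x j))"
    unfolding sample_adjoint_def
    by (simp add: L2_inner_sum_left L2_cmult L2 basis_L2 L2_inner_cmult_left coeff
        sum_distrib_left mult_ac)
qed

text \<open>The multiplier times \<open>lam i\<close> is
  \<open>(p i)\<^sup>2 * lam i powr \<beta>\<close>, the square of
  \<open>p i * lam i powr (\<beta> / 2)\<close>. One factor goes to the feature of the evaluated
  point, the other to the features summed by \<open>\<theta>\<close>.\<close>

lemma rls_matrix_eq_gram:
  fixes x :: "'n::finite \<Rightarrow> 'x" and p :: "nat \<Rightarrow> real" and \<beta> :: real
  assumes K: "\<And>s t. s \<in> space M \<Longrightarrow> t \<in> space M \<Longrightarrow> (\<lambda>i. lam i * \<psi> i s * \<psi> i t) sums K s t"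
    and lam: "\<And>i. lam i > 0" "bdd_above (range lam)" and x: "\<And>j. x j \<in> space M"
  defines "v \<equiv> \<lambda>j i. p i * lam i powr (\<beta> / 2) * \<psi> i (x j)"
  assumes v: "\<And>j. l2_seq (v j)"
  shows "rls_matrix M K lam \<psi> p \<beta> \<gamma> x = l2_gram v + (real CARD('n) * \<gamma>) *\<^sub>R mat 1"
proof -
  have "sample_spectral M \<psi> (\<lambda>i. (p i)\<^sup>2 * lam i powr (\<beta> - 1)) x (sample_adjoint K x \<theta>)
      = l2_gram v *v \<theta>" for \<theta>
  proof -
    have "(p i)\<^sup>2 * lam i powr (\<beta> - 1) * (lam i * (\<Sum>l\<in>UNIV. \<theta> $ l * \<psi> i (x l))) * \<psi> i (x j)
        = v j i * l2_adjoint v \<theta> i" for i j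
    proof -
      have "lam i powr (\<beta> - 1) * lam i = lam i powr (\<beta> / 2) * lam i powr (\<beta> / 2)"
        using lam(1)[of i] by (simp add: powr_diff flip: powr_add)
      then have "(p i)\<^sup>2 * (lam i powr (\<beta> - 1) * lam i) * \<psi> i (x j) * (\<Sum>l\<in>UNIV. \<theta> $ l * \<psi> i (x l))
          = v j i * (p i * lam i powr (\<beta> / 2) * (\<Sum>l\<in>UNIV. \<theta> $ l * \<psi> i (x l)))"
        by (simp add: v_def power2_eq_square mult_ac)
      also have "p i * lam i powr (\<beta> / 2) * (\<Sum>l\<in>UNIV. \<theta> $ l * \<psi> i (x l)) = l2_adjoint v \<theta> i"
        by (simp add: l2_adjoint_def v_def sum_distrib_left mult_ac)
      finally show ?thesis by (simp add: mult_ac)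
    qed
    then have "sample_spectral M \<psi> (\<lambda>i. (p i)\<^sup>2 * lam i powr (\<beta> - 1)) x (sample_adjoint K x \<theta>)
        = l2_sample v (l2_adjoint v \<theta>)"
      by (simp add: sample_spectral_def sample_adjoint_coeff[OF K lam x] l2_sample_def l2_inner_def)
    then show ?thesis
      by (simp add: l2_sample_adjoint[OF v])
  qed
  then show ?thesis
    by (simp add: rls_matrix_def)
qed

end

section \<open>The closed-form minimizer and its uniqueness up to null sets\<close>

theorem lemma3p1:
  fixes \<rho> :: "'x measure"
    and K :: "'x \<Rightarrow> 'x \<Rightarrow> real"
    and lam p :: "nat \<Rightarrow> real"
    and \<psi> :: "nat \<Rightarrow> 'x \<Rightarrow> real"
    and \<beta> \<gamma> :: real
    and x :: "'n::finite \<Rightarrow> 'x"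
    and y :: "real ^ 'n"
  assumes "prob_space \<rho>"
    and "L2_orthonormal_basis \<rho> \<psi>"
    and "\<And>i. lam i > 0"
    and "\<And>s t. s \<in> space \<rho> \<Longrightarrow> t \<in> space \<rho> \<Longrightarrow> (\<lambda>i. lam i * \<psi> i s * \<psi> i t) sums K s t"
    and "bdd_above (range lam)"
    and "\<And>i s. s \<in> space \<rho> \<Longrightarrow> covariance_op \<rho> K (\<psi> i) s = lam i * \<psi> i s"
    and "0 \<le> \<beta>" and "\<beta> \<le> 1"
    and "\<And>j. x j \<in> space \<rho>"
    and "\<And>j. summable (\<lambda>i. (p i)\<^sup>2 * lam i powr \<beta> * (\<psi> i (x j))\<^sup>2)"
    and "\<gamma> > 0"
  shows "invertible (rls_matrix \<rho> K lam \<psi> p \<beta> \<gamma> x) \<and>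
    (\<exists>fhat \<in> Hpow \<rho> lam \<psi> \<beta>.
       spectral_image \<rho> \<psi> (\<lambda>i. p i * lam i powr (\<beta> - 1))
         (sample_adjoint K x (matrix_inv (rls_matrix \<rho> K lam \<psi> p \<beta> \<gamma> x) *v y)) fhat \<and>
       (\<forall>f. is_arg_min (rls_objective \<rho> lam \<psi> p \<beta> \<gamma> x y) (\<lambda>g. g \<in> Hpow \<rho> lam \<psi> \<beta>) f \<longleftrightarrow>
            f \<in> L2_space \<rho> \<and> (AE t in \<rho>. f t = fhat t)))"
proof -
  interpret L2_orthonormal \<rho> \<psi>
    using assms(2) by unfold_locales (auto simp: L2_orthonormal_basis_def)
  note lam = assms(3) and K = assms(4) and bdd = assms(5) and x = assms(9)
  define v where "v = (\<lambda>j i. p i * lam i powr (\<beta> / 2) * \<psi> i (x j))"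
  define R where "R = rls_matrix \<rho> K lam \<psi> p \<beta> \<gamma> x"
  define \<theta> where "\<theta> = matrix_inv R *v y"
  define a0 where "a0 = l2_adjoint v \<theta>"
  have v: "l2_seq (v j)" for j
  proof -
    have "(v j i)\<^sup>2 = (p i)\<^sup>2 * lam i powr \<beta> * (\<psi> i (x j))\<^sup>2" for i
    proof -
      have "(lam i powr (\<beta> / 2))\<^sup>2 = lam i powr \<beta>"
        by (simp add: power2_eq_square flip: powr_add)
      then show ?thesis by (simp add: v_def power_mult_distrib)
    qed
    then show ?thesis using assms(10)[of j] by (simp add: l2_seq_def)
  qed
  have R: "R = l2_gram v + (real CARD('n) * \<gamma>) *\<^sub>R mat 1"
    unfolding R_def v_def by (rule rls_matrix_eq_gram[OF K lam bdd x v[unfolded v_def]])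
  have inv: "invertible R"
    unfolding R using \<open>\<gamma> > 0\<close> by (intro invertible_gram_plus_mat v) simp
  have "R ** matrix_inv R = mat 1"
    \<comment> \<open>\<open>matrix_inv\<close> is a choice of inverse; invertibility provides the
      witness.\<close>
    using someI_ex[OF inv[unfolded invertible_def]] by (simp add: matrix_inv_def)
  then have normal: "(l2_gram v + (real CARD('n) * \<gamma>) *\<^sub>R mat 1) *v \<theta> = y"
    unfolding \<theta>_def R[symmetric] by (simp add: matrix_vector_mul_assoc)
  have a0: "l2_seq a0"
    unfolding a0_def by (rule l2_seq_adjoint[OF v])
  obtain C where C: "\<And>i. lam i \<le> C" using bdd by (auto simp: bdd_above_def)
  \<comment> \<open>Riesz-Fischer needs the rescaled coefficients to be square-summable; this
    follows from \<open>lam i powr \<beta> \<le> C powr \<beta>\<close>.\<close>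
  have "summable (\<lambda>i. (a0 i * lam i powr (\<beta> / 2))\<^sup>2)"
  proof (rule summable_comparison_test)
    show "summable (\<lambda>i. C powr \<beta> * (a0 i)\<^sup>2)"
      using a0 by (intro summable_mult) (simp add: l2_seq_def)
    have "(a0 i * lam i powr (\<beta> / 2))\<^sup>2 \<le> C powr \<beta> * (a0 i)\<^sup>2" for i
    proof -
      have "(lam i powr (\<beta> / 2))\<^sup>2 = lam i powr \<beta>"
        by (simp add: power2_eq_square flip: powr_add)
      also have "\<dots> \<le> C powr \<beta>"
        using lam[of i] C[of i] \<open>0 \<le> \<beta>\<close> by (intro powr_mono2) auto
      finally have "(lam i powr (\<beta> / 2))\<^sup>2 * (a0 i)\<^sup>2 \<le> C powr \<beta> * (a0 i)\<^sup>2"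
        by (rule mult_right_mono) simp
      then show ?thesis by (simp add: power_mult_distrib mult.commute)
    qed
    then show "\<exists>N. \<forall>i\<ge>N. norm ((a0 i * lam i powr (\<beta> / 2))\<^sup>2) \<le> C powr \<beta> * (a0 i)\<^sup>2"
      by simp
  qed
  then obtain fhat where fhat: "L2_sums \<rho> (\<lambda>i t. a0 i * lam i powr (\<beta> / 2) * \<psi> i t) fhat"
    by (rule Riesz_Fischer)
  have rep: "Hpow_rep \<rho> lam \<psi> \<beta> a0 fhat"
    using fhat a0 by (simp add: Hpow_rep_def l2_seq_def)
  have spec: "spectral_image \<rho> \<psi> (\<lambda>i. p i * lam i powr (\<beta> - 1)) (sample_adjoint K x \<theta>) fhat"
  proof -
    have "p i * lam i powr (\<beta> - 1) * L2_inner \<rho> (sample_adjoint K x \<theta>) (\<psi> i)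
        = a0 i * lam i powr (\<beta> / 2)" for i
    proof -
      \<comment> \<open>One half power belongs to \<open>a0\<close>, the other is the weight in the
        definition of \<open>Hpow_rep\<close>.\<close>
      have "lam i powr (\<beta> - 1) * lam i = lam i powr (\<beta> / 2) * lam i powr (\<beta> / 2)"
        using lam[of i] by (simp add: powr_diff flip: powr_add)
      then have "p i * (lam i powr (\<beta> - 1) * lam i) * (\<Sum>j\<in>UNIV. \<theta> $ j * \<psi> i (x j))
          = p i * lam i powr (\<beta> / 2) * (\<Sum>j\<in>UNIV. \<theta> $ j * \<psi> i (x j)) * lam i powr (\<beta> / 2)"
        by (simp add: mult_ac)
      also have "p i * lam i powr (\<beta> / 2) * (\<Sum>j\<in>UNIV. \<theta> $ j * \<psi> i (x j)) = a0 i"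
        by (simp add: a0_def l2_adjoint_def v_def sum_distrib_left mult_ac)
      finally show ?thesis
        by (simp add: sample_adjoint_coeff[OF K lam bdd x] mult_ac)
    qed
    then show ?thesis
      using fhat sample_adjoint_L2[OF K lam bdd x] by (simp add: spectral_image_def)
  qed
  let ?J = "rls_objective \<rho> lam \<psi> p \<beta> \<gamma> x y"
  have decomp: "?J g = ?J fhat + (1 / real CARD('n) * (norm (l2_sample v (\<lambda>i. a i - a0 i)))\<^sup>2
      + \<gamma> * l2_inner (\<lambda>i. a i - a0 i) (\<lambda>i. a i - a0 i))" if "Hpow_rep \<rho> lam \<psi> \<beta> a g" for a g
    using ridge_objective_decomposition[OF v _ normal, of a] that
      rls_objective_eq_ridge[OF that lam, of p \<gamma> x y, folded v_def]
      rls_objective_eq_ridge[OF rep lam, of p \<gamma> x y, folded v_def]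
    by (simp add: Hpow_rep_def l2_seq_def a0_def)
  have min: "?J fhat \<le> ?J g" if "g \<in> Hpow \<rho> lam \<psi> \<beta>" for g
  proof -
    obtain a where a: "Hpow_rep \<rho> lam \<psi> \<beta> a g" using \<open>g \<in> _\<close> by (auto simp: Hpow_def)
    then have "0 \<le> l2_inner (\<lambda>i. a i - a0 i) (\<lambda>i. a i - a0 i)"
      using a0 by (intro l2_inner_self_nonneg l2_seq_diff) (auto simp: Hpow_rep_def l2_seq_def)
    then show ?thesis using decomp[OF a] \<open>\<gamma> > 0\<close> by simp
  qed
  \<comment> \<open>A minimizer is an \<open>L\<^sup>2\<close> class, hence a whole set of
    functions. The equivalence gives minimality of \<open>fhat\<close> and uniqueness at
    once.\<close>
  have "is_arg_min ?J (\<lambda>g. g \<in> Hpow \<rho> lam \<psi> \<beta>) f \<longleftrightarrow> f \<in> L2_space \<rho> \<and> (AE t in \<rho>. f t = fhat t)"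
    (is "?L \<longleftrightarrow> ?R") for f
  proof
    assume ?L
    then have f: "f \<in> Hpow \<rho> lam \<psi> \<beta>" and "\<not> ?J fhat < ?J f"
      using rep by (auto simp: is_arg_min_def Hpow_def)
    then have le: "?J f \<le> ?J fhat" by simp
    obtain a where a: "Hpow_rep \<rho> lam \<psi> \<beta> a f" using f by (auto simp: Hpow_def)
    define d where "d = (\<lambda>i. a i - a0 i)"
    have d: "l2_seq d"
      using a a0 unfolding d_def by (intro l2_seq_diff) (auto simp: Hpow_rep_def l2_seq_def)
    have "0 \<le> 1 / real CARD('n) * (norm (l2_sample v d))\<^sup>2" by simp
    \<comment> \<open>Since \<open>f\<close> does no worse than \<open>fhat\<close>, the excess is
      at most zero, and so is its penalty part.\<close>
    with le decomp[OF a] have "\<gamma> * l2_inner d d \<le> 0"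
      unfolding d_def[symmetric] by linarith
    with \<open>\<gamma> > 0\<close> l2_inner_self_nonneg[OF d] have "l2_inner d d = 0"
      by (simp add: mult_le_0_iff)
    then have "a = a0"
      using l2_inner_self_eq_0[OF d] by (auto simp: d_def)
    with a have "L2_sums \<rho> (\<lambda>i t. a0 i * lam i powr (\<beta> / 2) * \<psi> i t) f"
      by (simp add: Hpow_rep_def)
    with L2_sums_unique_AE[OF this fhat] show ?R by (simp add: L2_sums_def)
  next
    assume ?R
    then have "L2_sums \<rho> (\<lambda>i t. a0 i * lam i powr (\<beta> / 2) * \<psi> i t) f"
      using L2_sums_cong_AE[OF fhat] by blast
    then have f: "Hpow_rep \<rho> lam \<psi> \<beta> a0 f"
      using rep by (simp add: Hpow_rep_def)
    \<comment> \<open>The objective depends on a function only through its coefficients, here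
      \<open>a0\<close> for both.\<close>
    have "?J f = ?J fhat"
      by (simp add: rls_objective_eq_ridge[OF f lam] rls_objective_eq_ridge[OF rep lam])
    with min f show ?L
      by (auto simp: is_arg_min_def Hpow_def not_less)
  qed
  with rep spec inv show ?thesis
    unfolding R_def[symmetric] \<theta>_def by (auto simp: Hpow_def)
qed

end
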